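(* Let $n$ be a positive integer. Then there exist non-negative integers $a,b$ with $n = a^2+ab+b^2$ if and only if, in the prime factorization of $n$, every prime other than $3$ that is not of the form $6k+1$ ($k$ an integer) occurs with an even exponent. *)

theory Defs
  imports "HOL-Number_Theory.Number_Theory"
begin

end

theory Submission
  imports Defs "HOL-Library.Discrete_Functions"
begin

text \<open>
  The form \<open>a\<^sup>2 + ab + b\<^sup>2\<close> is the norm of \<open>a - b\<omega>\<close>, with \<open>\<omega>\<close> a primitive cube root of unity, so its
  values are closed under multiplication.

  A prime \<open>p\<close> with \<open>p mod 3 = 1\<close> is a value: there is a \<open>g\<close> with \<open>g\<^sup>2 + g + 1\<close> divisible by \<open>p\<close>, and Thue's
  lemma gives a nonzero \<open>(a, b)\<close> with entries below the square root of \<open>p\<close> and \<open>a\<close> congruent to \<open>gb\<close>.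
  The form is then a positive multiple of \<open>p\<close> less than \<open>3p\<close>; it is not \<open>2p\<close>, because its even values
  are divisible by 4.

  For \<open>p mod 3 = 2\<close> cubing is injective modulo \<open>p\<close>. If \<open>p\<close> divides the form, then \<open>a\<^sup>3\<close> and \<open>b\<^sup>3\<close> are congruent,
  hence so are \<open>a\<close> and \<open>b\<close>, and \<open>p\<close> divides both; therefore such primes can only be split off in
  pairs.
\<close>

section \<open>Multiplicativity of the norm form\<close>

text \<open>Expanding (a - b w)(c - d w) with w^2 = -1 - w gives (ac - bd) - (ad + bc + bd) w;
  taking norms yields the identity.\<close>

lemma eisenstein_form_mult:
  fixes a b c d :: int
  shows "(a\<^sup>2 + a * b + b\<^sup>2) * (c\<^sup>2 + c * d + d\<^sup>2) =
    (a * c - b * d)\<^sup>2 + (a * c - b * d) * (a * d + b * c + b * d) + (a * d + b * c + b * d)\<^sup>2"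
  by (simp add: power2_eq_square algebra_simps)

text \<open>The composition formula can produce the negative entry ac - bd. The lines
  \<open>a = 0\<close>, \<open>b = 0\<close> and \<open>a + b = 0\<close> cut the plane into six
  sectors, and a linear symmetry of the form carries each of them into the first quadrant.\<close>

lemma eisenstein_form_nonneg_witnesses:
  fixes a b :: int
  shows "\<exists>c d :: nat. a\<^sup>2 + a * b + b\<^sup>2 = int (c\<^sup>2 + c * d + d\<^sup>2)"
proof -
  have *: "\<exists>c d :: nat. a\<^sup>2 + a * b + b\<^sup>2 = int (c\<^sup>2 + c * d + d\<^sup>2)"
    if "c' \<ge> 0" "d' \<ge> 0" "a\<^sup>2 + a * b + b\<^sup>2 = c'\<^sup>2 + c' * d' + d'\<^sup>2" for c' d' :: int
    using that by (intro exI[of _ "nat c'"] exI[of _ "nat d'"]) simp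
  consider "a \<ge> 0" "b \<ge> 0" | "a \<le> 0" "b \<le> 0" | "a \<ge> 0" "b \<le> 0" "a + b \<ge> 0"
    | "a \<ge> 0" "b \<le> 0" "a + b \<le> 0" | "a \<le> 0" "b \<ge> 0" "a + b \<ge> 0"
    | "a \<le> 0" "b \<ge> 0" "a + b \<le> 0"
    by linarith
  then show ?thesis
  proof cases
    case 1 then show ?thesis by (intro *[of a b]) auto
  next
    case 2 then show ?thesis by (intro *[of "-a" "-b"]) auto
  next
    case 3 then show ?thesis by (intro *[of "a + b" "-b"]) (auto simp: power2_eq_square algebra_simps)
  next
    case 4 then show ?thesis by (intro *[of "-(a + b)" a]) (auto simp: power2_eq_square algebra_simps)
  next
    case 5 then show ?thesis by (intro *[of "a + b" "-a"]) (auto simp: power2_eq_square algebra_simps)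
  next
    case 6 then show ?thesis by (intro *[of "-(a + b)" b]) (auto simp: power2_eq_square algebra_simps)
  qed
qed

lemma eisenstein_form_closed_mult:
  fixes a b c d :: nat
  shows "\<exists>x y :: nat. (a\<^sup>2 + a * b + b\<^sup>2) * (c\<^sup>2 + c * d + d\<^sup>2) = x\<^sup>2 + x * y + y\<^sup>2"
proof -
  obtain x y :: nat where
    "int ((a\<^sup>2 + a * b + b\<^sup>2) * (c\<^sup>2 + c * d + d\<^sup>2)) = int (x\<^sup>2 + x * y + y\<^sup>2)"
    using eisenstein_form_mult[of "int a" "int b" "int c" "int d"]
      eisenstein_form_nonneg_witnesses[of "int a * int c - int b * int d"
        "int a * int d + int b * int c + int b * int d"]
    by auto
  then show ?thesis
    by (metis of_nat_eq_iff)
qed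

section \<open>Primes congruent to 1 modulo 3\<close>

text \<open>Pigeonhole: there are \<open>(Suc k)^2\<close> pairs with entries in 0..k but only
  \<open>m\<close> residues of \<open>x - g * y\<close>. The difference of two colliding pairs is
  the required small pair.\<close>

lemma thue_lemma:
  fixes g :: int
  assumes "m > 0" "m < (Suc k)\<^sup>2"
  shows "\<exists>a b :: int. (a, b) \<noteq> (0, 0) \<and> \<bar>a\<bar> \<le> int k \<and> \<bar>b\<bar> \<le> int k \<and> int m dvd (a - g * b)"
proof -
  define F where "F = (\<lambda>(x, y). (int x - g * int y) mod int m)"
  have "F ` ({..k} \<times> {..k}) \<subseteq> {0..<int m}"
    using assms(1) by (auto simp: F_def)
  then have "card (F ` ({..k} \<times> {..k})) \<le> m"
    using card_mono[of "{0..<int m}"] by simp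
  also have "\<dots> < card ({..k} \<times> {..k})"
    using assms(2) by (simp add: power2_eq_square)
  finally have "\<not> inj_on F ({..k} \<times> {..k})"
    by (rule pigeonhole)
  then obtain x y x' y' where xy: "x \<le> k" "y \<le> k" "x' \<le> k" "y' \<le> k" "(x, y) \<noteq> (x', y')"
    and eq: "F (x, y) = F (x', y')"
    by (auto simp: inj_on_def)
  from eq have "int m dvd (int x - g * int y) - (int x' - g * int y')"
    by (simp add: F_def mod_eq_dvd_iff)
  also have "\<dots> = (int x - int x') - g * (int y - int y')"
    by (simp add: algebra_simps)
  finally show ?thesis
    using xy by (intro exI[of _ "int x - int x'"] exI[of _ "int y - int y'"]) auto
qed

text \<open>The power of a primitive root with exponent (p - 1)/3 has order 3, so \<open>p\<close>
  divides \<open>g^3 - 1\<close> but not its factor \<open>g - 1\<close>.\<close>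

lemma prime_cube_root_of_unity:
  fixes p :: nat
  assumes "prime p" "p mod 3 = 1"
  shows "\<exists>g :: int. int p dvd g\<^sup>2 + g + 1"
proof -
  obtain r where r: "residue_primroot p r"
    using assms(1) prime_primitive_root_exists[of p] prime_gt_1_nat by blast
  then have ord: "ord p r = p - 1"
    using assms(1) by (simp add: residue_primroot_def totient_prime)
  define m where "m = (p - 1) div 3"
  have pm: "p - 1 = 3 * m" and m: "0 < m" "m < p - 1"
    using assms prime_gt_1_nat[of p] unfolding m_def by presburger+
  define g where "g = int (r ^ m)"
  have "[r ^ (p - 1) = 1] (mod p)"
    using ord ord_divides by force
  then have "[int (r ^ (p - 1)) = int 1] (mod int p)"
    by (simp only: cong_int_iff)
  moreover have "int (r ^ (p - 1)) = g ^ 3"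
    unfolding g_def pm by (simp add: mult.commute flip: power_mult)
  ultimately have "[g ^ 3 = 1] (mod int p)"
    by simp
  then have "int p dvd g ^ 3 - 1"
    by (simp add: cong_iff_dvd_diff)
  also have "g ^ 3 - 1 = (g - 1) * (g\<^sup>2 + g + 1)"
    by (simp add: power2_eq_square power3_eq_cube algebra_simps)
  finally have dvd: "int p dvd g - 1 \<or> int p dvd g\<^sup>2 + g + 1"
    using assms(1) prime_dvd_mult_iff[of "int p"] by simp
  have "\<not> [r ^ m = 1] (mod p)"
    using ord m ord_divides[of r m p] by (auto dest: dvd_imp_le)
  then have "\<not> [g = int 1] (mod int p)"
    unfolding g_def by (simp only: cong_int_iff not_False_eq_True)
  then have "\<not> int p dvd g - 1"
    by (simp add: cong_iff_dvd_diff)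
  with dvd show ?thesis by blast
qed

text \<open>If either entry is odd, so is the form; hence both entries are even and a factor 4 comes
  out.\<close>

lemma even_eisenstein_form:
  fixes a b :: int
  assumes "even (a\<^sup>2 + a * b + b\<^sup>2)"
  shows "4 dvd a\<^sup>2 + a * b + b\<^sup>2"
proof -
  have "even a" "even b"
    using assms by auto
  then obtain c d where "a = 2 * c" "b = 2 * d"
    by (elim evenE)
  then have "a\<^sup>2 + a * b + b\<^sup>2 = 4 * (c\<^sup>2 + c * d + d\<^sup>2)"
    by (simp add: power2_eq_square algebra_simps)
  then show ?thesis by simp
qed

lemma eisenstein_form_pos:
  fixes a b :: int
  assumes "(a, b) \<noteq> (0, 0)"
  shows "a\<^sup>2 + a * b + b\<^sup>2 > 0"
proof -
  have "2 * (a\<^sup>2 + a * b + b\<^sup>2) = a\<^sup>2 + b\<^sup>2 + (a + b)\<^sup>2"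
    by (simp add: power2_eq_square algebra_simps)
  moreover have "a\<^sup>2 + b\<^sup>2 > 0"
    using assms by (auto simp: sum_power2_gt_zero_iff)
  ultimately have "2 * (a\<^sup>2 + a * b + b\<^sup>2) > 0"
    by (metis add_pos_nonneg zero_le_power2)
  then show ?thesis
    by (simp only: zero_less_mult_iff) simp
qed

lemma prime_1_mod_3_eisenstein_form:
  fixes p :: nat
  assumes "prime p" "p mod 3 = 1"
  shows "\<exists>a b :: nat. p = a\<^sup>2 + a * b + b\<^sup>2"
proof -
  obtain g :: int where g: "int p dvd g\<^sup>2 + g + 1"
    using prime_cube_root_of_unity assms by blast
  define k where "k = floor_sqrt p"
  have "p < (Suc k)\<^sup>2"
    unfolding k_def by (rule Suc_floor_sqrt_power2_gt)
  then obtain a b :: int where ab: "(a, b) \<noteq> (0, 0)" "\<bar>a\<bar> \<le> int k" "\<bar>b\<bar> \<le> int k"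
    and dvd: "int p dvd a - g * b"
    using thue_lemma[of p k g] prime_gt_0_nat[OF assms(1)] by blast
  define N where "N = a\<^sup>2 + a * b + b\<^sup>2"
  have "k\<^sup>2 \<le> p"
    unfolding k_def by (rule floor_sqrt_power2_le)
  \<comment> \<open>A prime is not a square. The resulting strict bound on \<open>k^2\<close> is
    what keeps \<open>N\<close> below \<open>3 * p\<close> rather than at most equal to it.\<close>
  moreover have "k\<^sup>2 \<noteq> p"
    using assms(1) by (auto simp: prime_power_iff)
  ultimately have k: "int k ^ 2 < int p"
    by (metis le_neq_implies_less of_nat_less_iff of_nat_power)
  \<comment> \<open>Putting a = gb turns the form into \<open>b^2 * (g^2 + g + 1)\<close>; the first
    summand is the error, a multiple of \<open>a - g * b\<close>.\<close>
  have "N = (a - g * b) * (a + g * b + b) + b\<^sup>2 * (g\<^sup>2 + g + 1)"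
    by (simp add: N_def power2_eq_square algebra_simps)
  then have "int p dvd N"
    using dvd g by simp
  then obtain c where c: "N = int p * c" ..
  have "\<bar>a * b\<bar> \<le> int k ^ 2"
    using ab by (simp add: abs_mult power2_eq_square mult_mono)
  moreover have "a\<^sup>2 \<le> int k ^ 2" "b\<^sup>2 \<le> int k ^ 2"
    using ab by (simp_all add: abs_le_square_iff [symmetric])
  ultimately have "N < 3 * int p"
    using k unfolding N_def by linarith
  moreover have "0 < N"
    unfolding N_def using ab(1) by (rule eisenstein_form_pos)
  ultimately have "0 < c" "c < 3"
    using c prime_gt_0_nat[OF assms(1)] by (simp_all add: zero_less_mult_iff mult.commute[of _ c])
  moreover have "c \<noteq> 2"
  proof
    assume "c = 2"
    then have "4 dvd 2 * int p"
      using c even_eisenstein_form[of a b] by (simp add: N_def mult.commute)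
    then have "even p"
      by presburger
    then have "p = 2"
      using assms(1) primes_dvd_imp_eq two_is_prime_nat by blast
    with assms(2) show False by simp
  qed
  ultimately have "c = 1" by linarith
  then have "int p = a\<^sup>2 + a * b + b\<^sup>2"
    using c by (simp add: N_def)
  then show ?thesis
    using eisenstein_form_nonneg_witnesses[of a b] by (metis of_nat_eq_iff)
qed

section \<open>Primes congruent to 2 modulo 3\<close>

lemma prime_2_mod_3_dvd_eisenstein_form:
  fixes p a b :: nat
  assumes "prime p" "p mod 3 = 2" "p dvd a\<^sup>2 + a * b + b\<^sup>2"
  shows "p dvd a" "p dvd b"
proof -
  have "p dvd a \<and> p dvd b"
  proof (cases "p dvd a \<or> p dvd b")
    case True
    then show ?thesis
    proof
      assume a: "p dvd a"
      then have "p dvd b\<^sup>2"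
        using assms(3) by (simp add: power2_eq_square dvd_add_right_iff)
      then show ?thesis
        using a assms(1) prime_dvd_power by blast
    next
      assume b: "p dvd b"
      then have "p dvd a\<^sup>2"
        using assms(3) by (simp add: power2_eq_square dvd_add_left_iff)
      then show ?thesis
        using b assms(1) prime_dvd_power by blast
    qed
  next
    case False
    \<comment> \<open>With \<open>p - 1 = 3 * m + 1\<close>, Fermat makes a unit x the inverse of
      (x^3)^m, so a unit is determined by its cube.\<close>
    define m where "m = p div 3"
    have p: "p - 1 = 3 * m + 1"
      using assms(2) unfolding m_def by presburger
    let ?N = "a\<^sup>2 + a * b + b\<^sup>2"
    have N: "[?N = 0] (mod p)"
      using assms(3) by (simp add: cong_0_iff)
    \<comment> \<open>This is a^3 - b^3 = (a - b)N, arranged as an equality of sums to avoid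
      truncated subtraction.\<close>
    have "[a ^ 3 + b * ?N = a ^ 3 + b * 0] (mod p)"
      by (intro cong_add cong_mult cong_refl N)
    moreover have "[b ^ 3 + a * ?N = b ^ 3 + a * 0] (mod p)"
      by (intro cong_add cong_mult cong_refl N)
    moreover have "a ^ 3 + b * ?N = b ^ 3 + a * ?N"
      by (simp add: power2_eq_square power3_eq_cube algebra_simps)
    ultimately have "[a ^ 3 = b ^ 3] (mod p)"
      by (metis add_0_right cong_sym cong_trans mult_0_right)
    then have "[(a ^ 3) ^ m = (b ^ 3) ^ m] (mod p)"
      by (rule cong_pow)
    then have pow: "[a ^ (3 * m) = b ^ (3 * m)] (mod p)"
      by (simp add: power_mult)
    have "[a ^ (p - 1) = 1] (mod p)" "[b ^ (p - 1) = 1] (mod p)"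
      using False assms(1) fermat_theorem by blast+
    then have "[b ^ (3 * m) * b = a ^ (3 * m) * a] (mod p)"
      unfolding p by (metis cong_sym cong_trans power_add power_one_right)
    then have "[b ^ (3 * m) * b = b ^ (3 * m) * a] (mod p)"
      using pow by (meson cong_refl cong_mult cong_trans)
    moreover have "coprime (b ^ (3 * m)) p"
      using False assms(1) by (metis coprime_commute coprime_power_left_iff prime_imp_coprime)
    ultimately have ab: "[b = a] (mod p)"
      by (simp add: cong_mult_lcancel_nat)
    \<comment> \<open>With b congruent to a the form becomes 3a^2, which forces \<open>p\<close> to
      divide \<open>a\<close> and so refutes this case.\<close>
    have "[?N = a\<^sup>2 + a * a + a\<^sup>2] (mod p)"
      by (intro cong_add cong_mult cong_pow cong_refl ab)
    then have "p dvd a\<^sup>2 + a * a + a\<^sup>2"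
      using assms(3) cong_dvd_iff by blast
    also have "a\<^sup>2 + a * a + a\<^sup>2 = 3 * a\<^sup>2"
      by (simp add: power2_eq_square)
    finally have "p dvd 3 * a\<^sup>2" .
    moreover have "\<not> p dvd 3"
      using assms(1,2) primes_dvd_imp_eq[of p 3] by auto
    ultimately show ?thesis
      using assms(1) False by (auto simp: prime_dvd_mult_iff dest: prime_dvd_power)
  qed
  then show "p dvd a" "p dvd b" by auto
qed

text \<open>Descent on \<open>a + b\<close>: if \<open>p\<close> divides the form, dividing both
  entries by \<open>p\<close> lowers the multiplicity by exactly 2.\<close>

lemma even_multiplicity_eisenstein_form:
  fixes p a b :: nat
  assumes "prime p" "p mod 3 = 2" "a\<^sup>2 + a * b + b\<^sup>2 > 0"
  shows "even (multiplicity p (a\<^sup>2 + a * b + b\<^sup>2))"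
  using assms(3)
proof (induction "a + b" arbitrary: a b rule: less_induct)
  case less
  show ?case
  proof (cases "p dvd a\<^sup>2 + a * b + b\<^sup>2")
    case False
    then show ?thesis by (simp add: not_dvd_imp_multiplicity_0)
  next
    case True
    then obtain c d where cd: "a = p * c" "b = p * d"
      using prime_2_mod_3_dvd_eisenstein_form[OF assms(1,2)] by (meson dvdE)
    have eq: "a\<^sup>2 + a * b + b\<^sup>2 = p * (p * (c\<^sup>2 + c * d + d\<^sup>2))"
      by (simp add: cd power2_eq_square algebra_simps)
    have p: "p > 1" using assms(1) by (rule prime_gt_1_nat)
    have pos: "c\<^sup>2 + c * d + d\<^sup>2 > 0"
      using less.prems unfolding eq by simp
    then have "c + d > 0" by (cases "c = 0") auto
    then have "c + d < p * (c + d)"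
      using p by simp
    then have "c + d < a + b"
      by (simp add: cd algebra_simps)
    then have "even (multiplicity p (c\<^sup>2 + c * d + d\<^sup>2))"
      using pos by (rule less.hyps)
    then show ?thesis
      unfolding eq using pos p by (simp add: multiplicity_times_same)
  qed
qed

section \<open>Building n from its prime factors\<close>

lemma prime_mod_3_cases:
  fixes p :: nat
  assumes "prime p"
  shows "p = 3 \<or> p mod 3 = 1 \<or> p mod 3 = 2"
proof -
  have "p = 3 \<or> \<not> 3 dvd p"
    using assms primes_dvd_imp_eq[of 3 p] by auto
  then show ?thesis
    by presburger
qed

text \<open>Strong induction on \<open>n\<close>: split off \<open>p^2\<close> if
  \<open>p mod 3 = 2\<close>, and otherwise \<open>p\<close>, which is itself a value. Either way
  the parities of the relevant multiplicities survive in the cofactor.\<close>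

lemma eisenstein_form_if_even_multiplicities:
  fixes n :: nat
  assumes "n > 0" "\<And>p. prime p \<Longrightarrow> p mod 3 = 2 \<Longrightarrow> even (multiplicity p n)"
  shows "\<exists>a b :: nat. n = a\<^sup>2 + a * b + b\<^sup>2"
  using assms
proof (induction n rule: less_induct)
  case (less n)
  show ?case
  proof (cases "n = 1")
    case True
    then show ?thesis by (intro exI[of _ 1] exI[of _ 0]) simp
  next
    case False
    then obtain p where p: "prime p" "p dvd n"
      using prime_factor_nat by blast
    have p1: "p > 1" using p(1) by (rule prime_gt_1_nat)
    show ?thesis
    proof (cases "p mod 3 = 2")
      case True
      then have "even (multiplicity p n)"
        using less.prems p by blast
      moreover have "multiplicity p n > 0"
        using p p1 less.prems by (simp add: multiplicity_gt_zero_iff)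
      ultimately have "multiplicity p n \<ge> 2"
        by presburger
      then have "p\<^sup>2 dvd n"
        by (rule multiplicity_dvd')
      then obtain m where m: "n = p\<^sup>2 * m" ..
      have m0: "m > 0" using m less.prems by (auto intro: Nat.gr0I)
      have "m < n"
        using m m0 p1 one_less_power[of p 2] by simp
      moreover have "even (multiplicity q m)" if q: "prime q" "q mod 3 = 2" for q
      proof -
        have "multiplicity q n = 2 * multiplicity q p + multiplicity q m"
          using m m0 p1 q by (simp add: prime_elem_multiplicity_mult_distrib prime_elem_multiplicity_power_distrib)
        then show ?thesis
          using less.prems(2)[OF q] by simp
      qed
      ultimately obtain a b where "m = a\<^sup>2 + a * b + b\<^sup>2"
        using less.IH m0 by blast
      \<comment> \<open>The factor \<open>p^2\<close> is absorbed by scaling both entries by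
        \<open>p\<close>.\<close>
      then have "n = (p * a)\<^sup>2 + (p * a) * (p * b) + (p * b)\<^sup>2"
        using m by (simp add: power2_eq_square algebra_simps)
      then show ?thesis by blast
    next
      case False
      then have "p = 3 \<or> p mod 3 = 1"
        using prime_mod_3_cases[OF p(1)] by blast
      then obtain c d where cd: "p = c\<^sup>2 + c * d + d\<^sup>2"
      proof
        assume "p = 3"
        then show ?thesis by (intro that[of 1 1]) simp
      next
        assume "p mod 3 = 1"
        then show ?thesis
          using prime_1_mod_3_eisenstein_form p(1) that by blast
      qed
      obtain m where m: "n = p * m" using p(2) ..
      have m0: "m > 0" using m less.prems by (auto intro: Nat.gr0I)
      have "m < n"
        using m m0 p1 by simp
      moreover have "even (multiplicity q m)" if q: "prime q" "q mod 3 = 2" for q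
      proof -
        have "\<not> q dvd p"
          using q p(1) False primes_dvd_imp_eq by blast
        then have "multiplicity q n = multiplicity q m"
          using m m0 p1 q by (simp add: prime_elem_multiplicity_mult_distrib not_dvd_imp_multiplicity_0)
        then show ?thesis
          using less.prems(2)[OF q] by simp
      qed
      ultimately obtain a b where "m = a\<^sup>2 + a * b + b\<^sup>2"
        using less.IH m0 by blast
      then show ?thesis
        using eisenstein_form_closed_mult[of c d a b] m cd by simp
    qed
  qed
qed

text \<open>The only even prime, 2, has residue 2 modulo 3; a prime with residue 1 is therefore odd,
  hence 1 modulo 6.\<close>

lemma prime_2_mod_3_iff:
  fixes p :: nat
  assumes "prime p"
  shows "p mod 3 = 2 \<longleftrightarrow> p \<noteq> 3 \<and> \<not> (\<exists>k :: int. int p = 6 * k + 1)"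
proof -
  have "p = 2 \<or> odd p"
    using assms primes_dvd_imp_eq[of 2 p] by auto
  then show ?thesis
    using prime_mod_3_cases[OF assms] by presburger
qed

theorem theorem16:
  fixes n :: nat
  assumes "n > 0"
  shows "(\<exists>a b :: nat. n = a\<^sup>2 + a * b + b\<^sup>2) \<longleftrightarrow>
         (\<forall>p :: nat. prime p \<and> p \<noteq> 3 \<and> \<not> (\<exists>k :: int. int p = 6 * k + 1) \<longrightarrow>
            even (multiplicity p n))"
  using even_multiplicity_eisenstein_form eisenstein_form_if_even_multiplicities[OF assms]
    prime_2_mod_3_iff assms
  by metis

end
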